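(* Let $m\geq4$, let $\hat{\mathbf m}=(m-1)\,m\,(m-2)(m-3)\cdots321\in S_m$, and write $c=\cos\left(\frac{\pi}{m+1}\right)$. Then as $n\to\infty$, $$\mathbb{E}^{\hat{\mathbf m}}(L_n)\sim \frac{U_2(c)+\sum_{j=2}^{m-1}U_j^2(c)}{2^{m+1}c^3\,U_{m-1}(c)\prod_{j=2}^{m-1}\left(c-\cos\left(\frac{j\pi}{m+1}\right)\right)}\,n.$$
   Context: $S_n(312,\tau)$ is the set of permutations of $[n]$ avoiding both patterns $312$ and $\tau$. $L_n(\sigma)$ is the length of a longest increasing subsequence of $\sigma$, and $\mathbb{E}^{\tau}$ denotes expectation under the uniform distribution on $S_n(312,\tau)$. $U_j$ is the Chebyshev polynomial of the second kind: $U_0(t)=1$, $U_1(t)=2t$, $U_j(t)=2tU_{j-1}(t)-U_{j-2}(t)$. $a_n\sim b_n$ means $a_n/b_n\to1$. *)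

theory Defs
  imports
    "HOL-Probability.Probability"
    "HOL-Library.Sublist"
    "HOL-Library.Landau_Symbols"
    "HOL-Combinatorics.Multiset_Permutations"
begin

(* Permutations of [n] are written in one-line notation, as lists in
   permutations_of_set {1..n}; patterns are lists as well. *)

definition order_isomorphic :: "nat list \<Rightarrow> nat list \<Rightarrow> bool" where
  "order_isomorphic xs ys \<longleftrightarrow> length xs = length ys \<and>
     (\<forall>i<length xs. \<forall>j<length xs. xs ! i < xs ! j \<longleftrightarrow> ys ! i < ys ! j)"

(* subseq is the not necessarily contiguous subsequence relation *)
definition contains_pattern :: "nat list \<Rightarrow> nat list \<Rightarrow> bool" where
  "contains_pattern \<sigma> \<tau> \<longleftrightarrow> (\<exists>xs. subseq xs \<sigma> \<and> order_isomorphic xs \<tau>)"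

definition avoids :: "nat list \<Rightarrow> nat list \<Rightarrow> bool" where
  "avoids \<sigma> \<tau> \<longleftrightarrow> \<not> contains_pattern \<sigma> \<tau>"

definition S_avoid312 :: "nat list \<Rightarrow> nat \<Rightarrow> nat list set" where
  "S_avoid312 \<tau> n =
     {\<sigma> \<in> permutations_of_set {1..n}. avoids \<sigma> [3, 1, 2] \<and> avoids \<sigma> \<tau>}"

definition longest_inc :: "nat list \<Rightarrow> nat" where
  "longest_inc \<sigma> = Max (length ` {xs. subseq xs \<sigma> \<and> sorted_wrt (<) xs})"

(* pmf_of_set is the uniform distribution only on a nonempty finite set; S_avoid312 \<tau> n is
   finite, and it contains the identity whenever \<tau> has a descent. *)
definition expected_longest_inc :: "nat list \<Rightarrow> nat \<Rightarrow> real" where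
  "expected_longest_inc \<tau> n =
     measure_pmf.expectation (pmf_of_set (S_avoid312 \<tau> n)) (\<lambda>\<sigma>. real (longest_inc \<sigma>))"

(* (m-1) m (m-2) (m-3) ... 3 2 1, for m \<ge> 2 *)
definition m_hat :: "nat \<Rightarrow> nat list" where
  "m_hat m = [m - 1, m] @ rev [1..<m - 1]"

fun chebyshev_U :: "nat \<Rightarrow> real \<Rightarrow> real" where
  "chebyshev_U 0 t = 1"
| "chebyshev_U (Suc 0) t = 2 * t"
| "chebyshev_U (Suc (Suc j)) t = 2 * t * chebyshev_U (Suc j) t - chebyshev_U j t"

end

theory Submission
  imports Defs
begin

text \<open>
  Splitting a 312-avoiding permutation at its least entry \<open>a\<close> as \<open>xs @ a # ys\<close>, every entry of
  \<open>xs\<close> lies below every entry of \<open>ys\<close>. The permutation avoids \<open>m_hat (m + 1)\<close> iff \<open>xs\<close> avoids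
  \<open>m_hat m\<close> and \<open>ys\<close> avoids \<open>m_hat (m + 1)\<close>, and its longest increasing subsequence has length
  \<open>max 1 (longest_inc xs) + longest_inc ys\<close>. Hence the generating functions of the
  number of permutations and of the total length satisfy \<open>F' = 1 + x F F'\<close> and
  \<open>G' = x ((G + 1) F' + F G')\<close>, where the prime is the step from \<open>m\<close> to \<open>m + 1\<close>. They are rational
  with denominators \<open>P\<^sub>m\<close> and \<open>P\<^sub>m\<^sup>2\<close>, where \<open>P\<^sub>m(1 / (4 t\<^sup>2)) = U\<^sub>m(t) / (2 t)\<^sup>m\<close>. The smallest root
  of \<open>P\<^sub>m\<close> is \<open>1 / (4 c\<^sup>2)\<close>, so it is a simple pole of the first function and a double pole of the
  second, and the quotient of the coefficients grows linearly.
\<close>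

subsection \<open>Pattern avoidance in direct sums\<close>

lemma subseq_imp_subset: "subseq xs ys \<Longrightarrow> set xs \<subseteq> set ys"
  by (auto elim: list_emb_set)

lemma subseq_singleton_right: "subseq xs [a] \<longleftrightarrow> xs = [] \<or> xs = [a]"
  by (cases xs) auto

lemma contains_pattern_mono: "contains_pattern \<sigma> \<tau> \<Longrightarrow> subseq \<sigma> \<sigma>' \<Longrightarrow> contains_pattern \<sigma>' \<tau>"
  unfolding contains_pattern_def using subseq_order.order_trans by blast

lemma avoids_mono: "avoids \<sigma>' \<tau> \<Longrightarrow> subseq \<sigma> \<sigma>' \<Longrightarrow> avoids \<sigma> \<tau>"
  unfolding avoids_def using contains_pattern_mono by blast

lemma order_isomorphic_map_strict_mono:
  assumes "strict_mono f"
  shows "order_isomorphic xs (map f ys) \<longleftrightarrow> order_isomorphic xs ys"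
  by (cases "length xs = length ys") (simp_all add: order_isomorphic_def strict_mono_less[OF assms])

lemma order_isomorphic_butlast:
  assumes "order_isomorphic (xs @ [x]) (ys @ [y])"
  shows "order_isomorphic xs ys"
proof -
  have len: "length xs = length ys" using assms by (simp add: order_isomorphic_def)
  have "xs ! i < xs ! j \<longleftrightarrow> ys ! i < ys ! j" if "i < length xs" "j < length xs" for i j
  proof -
    have "(xs @ [x]) ! i < (xs @ [x]) ! j \<longleftrightarrow> (ys @ [y]) ! i < (ys @ [y]) ! j"
      using assms that by (simp add: order_isomorphic_def)
    then show ?thesis using that len by (simp add: nth_append)
  qed
  then show ?thesis using len by (simp add: order_isomorphic_def)
qed

lemma order_isomorphic_snoc:
  assumes "order_isomorphic xs ys" "\<forall>z\<in>set xs. x < z" "\<forall>z\<in>set ys. y < z"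
  shows "order_isomorphic (xs @ [x]) (ys @ [y])"
proof -
  have len: "length xs = length ys" using assms(1) by (simp add: order_isomorphic_def)
  have iso: "xs ! i < xs ! j \<longleftrightarrow> ys ! i < ys ! j" if "i < length xs" "j < length xs" for i j
    using assms(1) that by (simp add: order_isomorphic_def)
  have less: "x < xs ! k" "y < ys ! k" if "k < length xs" for k
    using assms(2,3) that len by simp_all
  have "(xs @ [x]) ! i < (xs @ [x]) ! j \<longleftrightarrow> (ys @ [y]) ! i < (ys @ [y]) ! j"
    if i: "i < Suc (length xs)" and j: "j < Suc (length xs)" for i j
  proof -
    consider "i < length xs" "j < length xs" | "i = length xs" "j < length xs"
      | "i < length xs" "j = length xs" | "i = length xs" "j = length xs"
      using i j unfolding less_Suc_eq by blast
    then show ?thesis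
    proof cases
      case 1
      then show ?thesis using iso len by (simp add: nth_append)
    next
      case 2
      then show ?thesis using less[of j] len by (simp add: nth_append)
    next
      case 3
      then have "\<not> xs ! i < x" "\<not> ys ! i < y" using less[of i] by simp_all
      then show ?thesis using 3 len by (simp add: nth_append)
    next
      case 4
      then show ?thesis using len by (simp add: nth_append)
    qed
  qed
  then show ?thesis using len by (simp add: order_isomorphic_def)
qed

text \<open>A pattern whose first entry exceeds its last one is indecomposable under direct sums.\<close>

lemma contains_pattern_append:
  assumes "\<tau> \<noteq> []" "last \<tau> < hd \<tau>" "\<forall>x\<in>set xs. \<forall>y\<in>set ys. x < y"
  shows "contains_pattern (xs @ ys) \<tau> \<longleftrightarrow> contains_pattern xs \<tau> \<or> contains_pattern ys \<tau>"
proof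
  assume "contains_pattern (xs @ ys) \<tau>"
  then obtain zs where zs: "subseq zs (xs @ ys)" "order_isomorphic zs \<tau>"
    by (auto simp: contains_pattern_def)
  obtain us vs where uv: "zs = us @ vs" "subseq us xs" "subseq vs ys"
    using zs(1) by (rule subseq_appendE)
  \<comment> \<open>An occurrence meeting both parts would start in \<open>xs\<close> and end in
    \<open>ys\<close>, so its first entry would be below its last one, contrary to
    \<open>last \<tau> < hd \<tau>\<close>.\<close>
  have "us = [] \<or> vs = []"
  proof (rule ccontr)
    assume "\<not> (us = [] \<or> vs = [])"
    then have "us \<noteq> []" "vs \<noteq> []" by auto
    have len: "length zs = length \<tau>" using zs(2) by (simp add: order_isomorphic_def)
    have "hd us \<in> set xs" "last vs \<in> set ys"
      using subseq_imp_subset[OF uv(2)] subseq_imp_subset[OF uv(3)] \<open>us \<noteq> []\<close> \<open>vs \<noteq> []\<close> by auto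
    then have "hd zs < last zs" using assms(3) uv(1) \<open>us \<noteq> []\<close> \<open>vs \<noteq> []\<close> by auto
    then have "zs ! 0 < zs ! (length zs - 1)"
      using uv(1) \<open>us \<noteq> []\<close> by (simp add: hd_conv_nth last_conv_nth)
    then have "\<tau> ! 0 < \<tau> ! (length \<tau> - 1)"
      using zs(2) len assms(1) unfolding order_isomorphic_def
      by (metis One_nat_def diff_less length_greater_0_conv zero_less_one)
    then show False
      using assms(1,2) by (simp add: hd_conv_nth last_conv_nth)
  qed
  then show "contains_pattern xs \<tau> \<or> contains_pattern ys \<tau>"
    using uv zs(2) by (auto simp: contains_pattern_def)
next
  show "contains_pattern xs \<tau> \<or> contains_pattern ys \<tau> \<Longrightarrow> contains_pattern (xs @ ys) \<tau>"
    using contains_pattern_mono by (meson subseq_drop_many subseq_rev_drop_many subseq_order.order_refl)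
qed

text \<open>Deleting the last entry of an occurrence of \<open>\<tau> @ [l]\<close> leaves an
  occurrence of \<open>\<tau>\<close> inside \<open>xs\<close>, whether or not \<open>a\<close> was
  used. Conversely, \<open>a\<close> can play the part of \<open>l\<close>, both being
  least.\<close>

lemma contains_pattern_snoc_least:
  assumes "\<forall>x\<in>set xs. a < x" "\<forall>y\<in>set \<tau>. l < y"
  shows "contains_pattern (xs @ [a]) (\<tau> @ [l]) \<longleftrightarrow> contains_pattern xs \<tau>"
proof
  assume "contains_pattern (xs @ [a]) (\<tau> @ [l])"
  then obtain zs where zs: "subseq zs (xs @ [a])" "order_isomorphic zs (\<tau> @ [l])"
    by (auto simp: contains_pattern_def)
  have "zs \<noteq> []" using zs(2) by (auto simp: order_isomorphic_def)
  then obtain ys z where z: "zs = ys @ [z]" using rev_exhaust by blast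
  have "subseq ys xs"
  proof -
    obtain us vs where uv: "zs = us @ vs" "subseq us xs" "subseq vs [a]"
      using zs(1) by (rule subseq_appendE)
    from uv(3) consider "vs = []" | "vs = [a]"
      by (auto simp: subseq_singleton_right)
    then show ?thesis
    proof cases
      case 1
      then have "subseq (ys @ [z]) xs" using uv z by simp
      then show ?thesis by (metis subseq_order.dual_order.trans subseq_rev_drop_many subseq_order.order_refl)
    next
      case 2
      then show ?thesis using uv z by simp
    qed
  qed
  moreover have "order_isomorphic ys \<tau>" using zs(2) z order_isomorphic_butlast by blast
  ultimately show "contains_pattern xs \<tau>" by (auto simp: contains_pattern_def)
next
  assume "contains_pattern xs \<tau>"
  then obtain ys where ys: "subseq ys xs" "order_isomorphic ys \<tau>"
    by (auto simp: contains_pattern_def)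
  then have "order_isomorphic (ys @ [a]) (\<tau> @ [l])"
    using assms subseq_imp_subset[OF ys(1)] by (intro order_isomorphic_snoc) auto
  then show "contains_pattern (xs @ [a]) (\<tau> @ [l])"
    using ys(1) unfolding contains_pattern_def by (metis subseq_append)
qed

text \<open>This recursion makes induction on \<open>m\<close> possible, with the pattern 12 at
  \<open>m = 2\<close> as its base.\<close>

lemma m_hat_Suc: "m \<ge> 2 \<Longrightarrow> m_hat (Suc m) = map Suc (m_hat m) @ [1]"
proof -
  assume m: "m \<ge> 2"
  have "[1..<m] = 1 # map Suc [1..<m - 1]"
    using m by (simp add: map_Suc_upt upt_conv_Cons)
  then show ?thesis using m by (simp add: m_hat_def rev_map)
qed

lemma avoids_snoc_m_hat:
  assumes "m \<ge> 2" "\<forall>x\<in>set xs. a < x"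
  shows "avoids (xs @ [a]) (m_hat (Suc m)) \<longleftrightarrow> avoids xs (m_hat m)"
proof -
  have "\<forall>y\<in>set (map Suc (m_hat m)). 1 < y"
    using assms(1) by (auto simp: m_hat_def)
  then have "contains_pattern (xs @ [a]) (m_hat (Suc m)) \<longleftrightarrow> contains_pattern xs (map Suc (m_hat m))"
    using assms(2) unfolding m_hat_Suc[OF assms(1)] by (rule contains_pattern_snoc_least[rotated])
  then show ?thesis
    by (simp add: avoids_def contains_pattern_def order_isomorphic_map_strict_mono strict_mono_def)
qed

text \<open>The pattern begins with \<open>m\<close> and ends with 1, so no occurrence straddles the
  direct sum of \<open>xs @ [a]\<close> and \<open>ys\<close>. In the first summand the trailing
  minimum \<open>a\<close> uses up the trailing 1 of the pattern.\<close>

lemma avoids_direct_sum_m_hat: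
  assumes "m \<ge> 2" "\<forall>x\<in>set xs. a < x" "\<forall>x\<in>set (xs @ [a]). \<forall>y\<in>set ys. x < y"
  shows "avoids (xs @ a # ys) (m_hat (Suc m)) \<longleftrightarrow> avoids xs (m_hat m) \<and> avoids ys (m_hat (Suc m))"
proof -
  have "last (m_hat (Suc m)) = 1" using assms(1) by (simp add: m_hat_Suc)
  moreover have "hd (m_hat (Suc m)) = m" by (simp add: m_hat_def)
  ultimately have "last (m_hat (Suc m)) < hd (m_hat (Suc m))" using assms(1) by simp
  moreover have "m_hat (Suc m) \<noteq> []" by (simp add: m_hat_def)
  ultimately have "avoids ((xs @ [a]) @ ys) (m_hat (Suc m)) \<longleftrightarrow>
      avoids (xs @ [a]) (m_hat (Suc m)) \<and> avoids ys (m_hat (Suc m))"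
    unfolding avoids_def using contains_pattern_append[OF _ _ assms(3)] by blast
  then show ?thesis using avoids_snoc_m_hat[OF assms(1,2)] by simp
qed

text \<open>In an occurrence of 312 the entry \<open>a\<close> could only come last, as the 2, but
  it lies below the entry that would have to be the 1.\<close>

lemma avoids_312_snoc_least:
  assumes "\<forall>x\<in>set xs. a < x"
  shows "avoids (xs @ [a]) [3, 1, 2] \<longleftrightarrow> avoids xs [3, 1, 2]"
proof
  assume A: "avoids xs [3, 1, 2]"
  show "avoids (xs @ [a]) [3, 1, 2]"
    unfolding avoids_def
  proof
    assume "contains_pattern (xs @ [a]) [3, 1, 2]"
    then obtain zs where zs: "subseq zs (xs @ [a])" "order_isomorphic zs [3, 1, 2]"
      by (auto simp: contains_pattern_def)
    obtain us vs where uv: "zs = us @ vs" "subseq us xs" "subseq vs [a]"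
      using zs(1) by (rule subseq_appendE)
    have len: "length zs = 3" using zs(2) by (simp add: order_isomorphic_def)
    from uv(3) consider "vs = []" | "vs = [a]"
      by (auto simp: subseq_singleton_right)
    then show False
    proof cases
      case 1
      then show False using A uv zs(2) by (auto simp: avoids_def contains_pattern_def)
    next
      case 2
      then have "length us = 2" using uv len by simp
      then have "us ! 1 \<in> set us" by simp
      then have "a < us ! 1" using assms subseq_imp_subset[OF uv(2)] by blast
      moreover have "zs ! 1 < zs ! 2"
        using zs(2) len unfolding order_isomorphic_def by (auto dest!: spec[of _ 1])
      ultimately show False using uv(1) 2 \<open>length us = 2\<close> by (simp add: nth_append)
    qed
  qed
qed (rule avoids_mono, auto)

lemma avoids_312_direct_sum:
  assumes "\<forall>x\<in>set xs. a < x" "\<forall>x\<in>set (xs @ [a]). \<forall>y\<in>set ys. x < y"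
  shows "avoids (xs @ a # ys) [3, 1, 2] \<longleftrightarrow> avoids xs [3, 1, 2] \<and> avoids ys [3, 1, 2]"
proof -
  have "avoids ((xs @ [a]) @ ys) [3, 1, 2] \<longleftrightarrow> avoids (xs @ [a]) [3, 1, 2] \<and> avoids ys [3, 1, 2]"
    unfolding avoids_def using contains_pattern_append[OF _ _ assms(2), of "[3,1,2]"] by simp
  then show ?thesis using avoids_312_snoc_least[OF assms(1)] by simp
qed

text \<open>Otherwise \<open>x\<close>, \<open>a\<close>, \<open>y\<close> would form the pattern
  312. With \<open>a\<close> the minimum, this makes the split at \<open>a\<close> a direct
  sum.\<close>

lemma avoids_312_imp_less:
  assumes "avoids (xs @ a # ys) [3, 1, 2]" "x \<in> set xs" "y \<in> set ys" "a < y" "x \<noteq> y"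
  shows "x < y"
proof (rule ccontr)
  assume "\<not> x < y"
  then have "y < x" using assms(5) by simp
  have "subseq ([x] @ a # [y]) (xs @ a # ys)"
    using assms(2,3) by (intro list_emb_append_mono) (auto simp: subseq_singleton_left)
  moreover have "order_isomorphic [x, a, y] [3, 1, 2]"
    using \<open>y < x\<close> assms(4) by (auto simp: order_isomorphic_def less_Suc_eq numeral_3_eq_3 nth_Cons')
  ultimately show False using assms(1) by (auto simp: avoids_def contains_pattern_def)
qed

section \<open>Longest increasing subsequences of direct sums\<close>

lemma finite_subseqs: "finite {xs. subseq xs ys}"
  by (metis List.finite_set set_subseqs_eq)

lemma longest_inc_attained:
  obtains xs where "subseq xs \<sigma>" "sorted_wrt (<) xs" "length xs = longest_inc \<sigma>"
proof -
  let ?S = "{xs. subseq xs \<sigma> \<and> sorted_wrt (<) xs}"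
  have "[] \<in> ?S" by simp
  moreover have "finite ?S" by (rule finite_subset[OF _ finite_subseqs[of \<sigma>]]) auto
  ultimately have "longest_inc \<sigma> \<in> length ` ?S"
    unfolding longest_inc_def by (intro Max_in) auto
  then show ?thesis using that by auto
qed

lemma longest_inc_ge:
  assumes "subseq xs \<sigma>" "sorted_wrt (<) xs"
  shows "length xs \<le> longest_inc \<sigma>"
proof -
  have "finite {xs. subseq xs \<sigma> \<and> sorted_wrt (<) xs}"
    by (rule finite_subset[OF _ finite_subseqs[of \<sigma>]]) auto
  then show ?thesis unfolding longest_inc_def using assms by (intro Max_ge) auto
qed

text \<open>Cutting an increasing subsequence at the boundary gives one inequality, concatenating
  two optimal ones gives the other.\<close>

lemma longest_inc_append:
  assumes "\<forall>x\<in>set xs. \<forall>y\<in>set ys. x < y"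
  shows "longest_inc (xs @ ys) = longest_inc xs + longest_inc ys"
proof (rule antisym)
  obtain zs where zs: "subseq zs (xs @ ys)" "sorted_wrt (<) zs" "length zs = longest_inc (xs @ ys)"
    by (rule longest_inc_attained)
  obtain us vs where uv: "zs = us @ vs" "subseq us xs" "subseq vs ys"
    using zs(1) by (rule subseq_appendE)
  then show "longest_inc (xs @ ys) \<le> longest_inc xs + longest_inc ys"
    using uv longest_inc_ge[of us xs] longest_inc_ge[of vs ys] zs by (auto simp: sorted_wrt_append)
next
  obtain us where us: "subseq us xs" "sorted_wrt (<) us" "length us = longest_inc xs"
    by (rule longest_inc_attained)
  obtain vs where vs: "subseq vs ys" "sorted_wrt (<) vs" "length vs = longest_inc ys"
    by (rule longest_inc_attained)
  have "sorted_wrt (<) (us @ vs)"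
    using us(2) vs(2) assms subseq_imp_subset[OF us(1)] subseq_imp_subset[OF vs(1)]
    by (simp add: sorted_wrt_append subset_iff)
  then have "length (us @ vs) \<le> longest_inc (xs @ ys)"
    using us vs by (intro longest_inc_ge list_emb_append_mono)
  then show "longest_inc xs + longest_inc ys \<le> longest_inc (xs @ ys)"
    using us vs by simp
qed

text \<open>An increasing subsequence that uses the final minimum \<open>a\<close> is just
  \<open>[a]\<close>. It therefore matters only when \<open>xs\<close> is empty.\<close>

lemma longest_inc_snoc_least:
  assumes "\<forall>x\<in>set xs. a < x"
  shows "longest_inc (xs @ [a]) = max 1 (longest_inc xs)"
proof (rule antisym)
  obtain zs where zs: "subseq zs (xs @ [a])" "sorted_wrt (<) zs" "length zs = longest_inc (xs @ [a])"
    by (rule longest_inc_attained)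
  obtain us vs where uv: "zs = us @ vs" "subseq us xs" "subseq vs [a]"
    using zs(1) by (rule subseq_appendE)
  from uv(3) consider "vs = []" | "vs = [a]"
    by (auto simp: subseq_singleton_right)
  then show "longest_inc (xs @ [a]) \<le> max 1 (longest_inc xs)"
  proof cases
    case 1
    then show ?thesis using uv zs longest_inc_ge[of us xs] by simp
  next
    case 2
    have "us = []"
    proof (rule ccontr)
      assume "us \<noteq> []"
      then have "hd us < a" "hd us \<in> set xs"
        using zs(2) uv 2 subseq_imp_subset[OF uv(2)] by (auto simp: sorted_wrt_append)
      then show False using assms by auto
    qed
    then show ?thesis using zs(3) uv 2 by simp
  qed
next
  obtain us where us: "subseq us xs" "sorted_wrt (<) us" "length us = longest_inc xs"
    by (rule longest_inc_attained)
  then have "longest_inc xs \<le> longest_inc (xs @ [a])"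
    using longest_inc_ge[of us "xs @ [a]"] by (auto intro: subseq_rev_drop_many)
  moreover have "length [a] \<le> longest_inc (xs @ [a])"
    by (rule longest_inc_ge) (auto simp: subseq_singleton_left)
  ultimately show "max 1 (longest_inc xs) \<le> longest_inc (xs @ [a])" by simp
qed

lemma longest_inc_direct_sum:
  assumes "\<forall>x\<in>set xs. a < x" "\<forall>x\<in>set (xs @ [a]). \<forall>y\<in>set ys. x < y"
  shows "longest_inc (xs @ a # ys) = max 1 (longest_inc xs) + longest_inc ys"
  using longest_inc_append[OF assms(2)] longest_inc_snoc_least[OF assms(1)] by simp

subsection \<open>Splitting at the least entry\<close>

text \<open>The interval of values may start anywhere, so that both parts of a split permutation
  belong to such sets again without renumbering their entries.\<close>

definition avoiders :: "nat list \<Rightarrow> nat \<Rightarrow> nat \<Rightarrow> nat list set" where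
  "avoiders \<tau> a n = {\<sigma> \<in> permutations_of_set {a..<a + n}. avoids \<sigma> [3, 1, 2] \<and> avoids \<sigma> \<tau>}"

lemma S_avoid312_eq_avoiders: "S_avoid312 \<tau> n = avoiders \<tau> 1 n"
  by (simp add: S_avoid312_def avoiders_def atLeastLessThanSuc_atLeastAtMost)

lemma finite_avoiders [simp]: "finite (avoiders \<tau> a n)"
  by (simp add: avoiders_def)

lemma avoidersD:
  assumes "\<sigma> \<in> avoiders \<tau> a n"
  shows "set \<sigma> = {a..<a + n}" "distinct \<sigma>" "length \<sigma> = n"
proof -
  show *: "set \<sigma> = {a..<a + n}" "distinct \<sigma>"
    using assms by (auto simp: avoiders_def permutations_of_set_def)
  show "length \<sigma> = n"
    using distinct_card[OF *(2)] *(1) by simp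
qed

text \<open>Every number from \<open>l\<close> up to \<open>Max A\<close> lies in
  \<open>A \<union> B\<close>, and it cannot lie in \<open>B\<close> because \<open>B\<close> is
  above \<open>Max A\<close>. So the values occurring before the least entry are determined by their
  number alone.\<close>

lemma lower_part_interval:
  fixes A B :: "nat set"
  assumes "A \<union> B = {l..<u}" "\<forall>x\<in>A. \<forall>y\<in>B. x < y"
  shows "A = {l..<l + card A}"
proof (cases "A = {}")
  case False
  have fin: "finite A" using assms(1) by (metis finite_Un finite_atLeastLessThan)
  have "A = {l..<Suc (Max A)}"
  proof (intro equalityI subsetI)
    fix x assume "x \<in> A"
    then show "x \<in> {l..<Suc (Max A)}" using assms(1) fin by (auto simp: less_Suc_eq_le)
  next
    fix x assume x: "x \<in> {l..<Suc (Max A)}"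
    have M: "Max A \<in> A" using False fin by simp
    then have "Max A \<in> {l..<u}" using assms(1) by blast
    then have "x \<in> A \<union> B" using x assms(1) by simp
    moreover have "x \<notin> B"
      using assms(2) M x by fastforce
    ultimately show "x \<in> A" by blast
  qed
  moreover from this have "card A = Suc (Max A) - l" by (metis card_atLeastLessThan)
  moreover have "l \<le> Max A"
    using Max_in[OF fin False] assms(1) by (metis UnCI atLeastLessThan_iff)
  ultimately show ?thesis by simp
qed simp

text \<open>Here \<open>k\<close> is the number of entries before the minimum \<open>a\<close>.
  Avoidance of 312 puts them below the entries after \<open>a\<close>, so the two parts fill
  consecutive intervals; the direct sum criteria then treat both patterns.\<close>

lemma avoiders_decompose:
  assumes m: "m \<ge> 2"
  shows "avoiders (m_hat (Suc m)) a (Suc n) =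
    (\<Union>k\<le>n. (\<lambda>(xs, ys). xs @ a # ys) `
       (avoiders (m_hat m) (Suc a) k \<times> avoiders (m_hat (Suc m)) (Suc a + k) (n - k)))"
    (is "?L = ?R")
proof (intro equalityI subsetI)
  fix \<sigma> assume \<sigma>: "\<sigma> \<in> ?L"
  then have set: "set \<sigma> = {a..<a + Suc n}" and dist: "distinct \<sigma>"
    by (rule avoidersD)+
  have av: "avoids \<sigma> [3, 1, 2]" "avoids \<sigma> (m_hat (Suc m))"
    using \<sigma> by (auto simp: avoiders_def)
  have "a \<in> set \<sigma>" using set by simp
  then obtain xs ys where xy: "\<sigma> = xs @ a # ys"
    by (meson split_list)
  have un: "set xs \<union> set ys = {Suc a..<Suc a + n}"
  proof -
    have "set xs \<union> set ys = set \<sigma> - {a}" using dist xy by auto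
    also have "\<dots> = {a..<a + Suc n} - {a}" by (simp only: set)
    also have "\<dots> = {Suc a..<Suc a + n}" by auto
    finally show ?thesis .
  qed
  have gt: "a < x" if "x \<in> set xs \<union> set ys" for x
    using that un by simp
  have less: "x < y" if "x \<in> set xs" "y \<in> set ys" for x y
    using avoids_312_imp_less[OF av(1)[unfolded xy] that] gt dist xy that by auto
  define k where "k = length xs"
  have dxy: "distinct xs" "distinct ys" "set xs \<inter> set ys = {}"
    using dist xy by auto
  have cxs: "card (set xs) = k" using dxy by (simp add: k_def distinct_card)
  have sx: "set xs = {Suc a..<Suc a + k}"
    using lower_part_interval[OF un] less cxs by simp
  have "k \<le> n"
  proof -
    have "card (set xs) \<le> card {Suc a..<Suc a + n}"
      using un by (intro card_mono) auto
    then show ?thesis using cxs by simp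
  qed
  have sy: "set ys = {Suc a + k..<Suc a + k + (n - k)}"
  proof -
    have "set ys = (set xs \<union> set ys) - set xs" using dxy(3) by blast
    also have "\<dots> = {Suc a..<Suc a + n} - {Suc a..<Suc a + k}" using un sx by simp
    finally show ?thesis using \<open>k \<le> n\<close> by auto
  qed
  have 1: "\<forall>x\<in>set xs. a < x" and 2: "\<forall>x\<in>set (xs @ [a]). \<forall>y\<in>set ys. x < y"
    using gt less by auto
  have "xs \<in> avoiders (m_hat m) (Suc a) k"
    using av avoids_312_direct_sum[OF 1 2] avoids_direct_sum_m_hat[OF m 1 2] sx dxy xy
    by (simp add: avoiders_def permutations_of_set_def)
  moreover have "ys \<in> avoiders (m_hat (Suc m)) (Suc a + k) (n - k)"
    using av avoids_312_direct_sum[OF 1 2] avoids_direct_sum_m_hat[OF m 1 2] sy dxy xy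
    by (simp add: avoiders_def permutations_of_set_def)
  ultimately show "\<sigma> \<in> ?R"
    using \<open>k \<le> n\<close> xy by force
next
  fix \<sigma> assume "\<sigma> \<in> ?R"
  then obtain k xs ys where k: "k \<le> n" and xs: "xs \<in> avoiders (m_hat m) (Suc a) k"
    and ys: "ys \<in> avoiders (m_hat (Suc m)) (Suc a + k) (n - k)" and \<sigma>: "\<sigma> = xs @ a # ys"
    by auto
  note sx = avoidersD[OF xs] and sy = avoidersD[OF ys]
  have 1: "\<forall>x\<in>set xs. a < x" and 2: "\<forall>x\<in>set (xs @ [a]). \<forall>y\<in>set ys. x < y"
    using sx(1) sy(1) by auto
  have "set \<sigma> = {a..<a + Suc n}" using \<sigma> sx(1) sy(1) k by auto
  moreover have "distinct \<sigma>" using \<sigma> sx sy by auto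
  moreover have "avoids \<sigma> [3, 1, 2]" "avoids \<sigma> (m_hat (Suc m))"
    using xs ys avoids_312_direct_sum[OF 1 2] avoids_direct_sum_m_hat[OF m 1 2] \<sigma>
    by (auto simp: avoiders_def)
  ultimately show "\<sigma> \<in> ?L" by (simp add: avoiders_def permutations_of_set_def)
qed

text \<open>The entry \<open>a\<close> occurs exactly once, so its position recovers
  \<open>xs\<close>, \<open>ys\<close> and \<open>k\<close>. Hence the union is disjoint and each of
  its members is parametrized injectively.\<close>

lemma sum_avoiders_decompose:
  fixes f :: "nat list \<Rightarrow> real"
  assumes m: "m \<ge> 2"
  shows "(\<Sum>\<sigma>\<in>avoiders (m_hat (Suc m)) a (Suc n). f \<sigma>) =
    (\<Sum>k\<le>n. \<Sum>xs\<in>avoiders (m_hat m) (Suc a) k.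
       \<Sum>ys\<in>avoiders (m_hat (Suc m)) (Suc a + k) (n - k). f (xs @ a # ys))"
proof -
  let ?A = "\<lambda>k. avoiders (m_hat m) (Suc a) k"
  let ?B = "\<lambda>k. avoiders (m_hat (Suc m)) (Suc a + k) (n - k)"
  let ?g = "\<lambda>(xs, ys). xs @ a # ys"
  have notin: "a \<notin> set xs" if "xs \<in> ?A k" for xs k
    using avoidersD(1)[OF that] by simp
  have notin': "a \<notin> set xs" if "xs \<in> ?B k" for xs k
    using avoidersD(1)[OF that] by simp
  have inj: "xs = xs' \<and> ys = ys'"
    if "xs @ a # ys = xs' @ a # ys'" "xs \<in> ?A k" "ys \<in> ?B k" for xs ys xs' ys' k
    using that notin[OF that(2)] notin'[OF that(3)] append_Cons_eq_iff by metis
  have "(\<Sum>\<sigma>\<in>avoiders (m_hat (Suc m)) a (Suc n). f \<sigma>) = (\<Sum>k\<le>n. \<Sum>\<sigma>\<in>?g ` (?A k \<times> ?B k). f \<sigma>)"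
    unfolding avoiders_decompose[OF m]
  proof (rule sum.UNION_disjoint)
    show "\<forall>i\<in>{..n}. \<forall>j\<in>{..n}. i \<noteq> j \<longrightarrow> ?g ` (?A i \<times> ?B i) \<inter> ?g ` (?A j \<times> ?B j) = {}"
    proof (intro ballI impI, rule ccontr)
      fix i j assume "i \<noteq> j" "?g ` (?A i \<times> ?B i) \<inter> ?g ` (?A j \<times> ?B j) \<noteq> {}"
      then obtain xs ys xs' ys' where *: "xs \<in> ?A i" "ys \<in> ?B i" "xs' \<in> ?A j"
        "xs @ a # ys = xs' @ a # ys'" by auto
      then have "xs = xs'" using inj by blast
      then show False using avoidersD(3)[OF *(1)] avoidersD(3)[OF *(3)] \<open>i \<noteq> j\<close> by simp
    qed
  qed auto
  also have "\<dots> = (\<Sum>k\<le>n. \<Sum>p\<in>?A k \<times> ?B k. f (?g p))"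
  proof (rule sum.cong[OF refl])
    fix k
    have "inj_on ?g (?A k \<times> ?B k)"
    proof (rule inj_onI)
      fix p q assume "p \<in> ?A k \<times> ?B k" "q \<in> ?A k \<times> ?B k" "?g p = ?g q"
      then show "p = q"
        using inj[of "fst p" "snd p" "fst q" "snd q" k]
        by (simp add: split_def mem_Times_iff prod_eq_iff)
    qed
    then show "(\<Sum>\<sigma>\<in>?g ` (?A k \<times> ?B k). f \<sigma>) = (\<Sum>p\<in>?A k \<times> ?B k. f (?g p))"
      by (simp add: sum.reindex)
  qed
  also have "\<dots> = (\<Sum>k\<le>n. \<Sum>xs\<in>?A k. \<Sum>ys\<in>?B k. f (xs @ a # ys))"
    by (simp add: sum.cartesian_product split_def)
  finally show ?thesis .
qed

section \<open>The base pattern 12 and decreasing permutations\<close>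

lemma avoids_12_imp_decreasing:
  assumes "avoids xs [1, 2]" "distinct xs"
  shows "sorted_wrt (>) xs"
  using assms
proof (induction xs)
  case (Cons x xs)
  have "y < x" if "y \<in> set xs" for y
  proof (rule ccontr)
    assume "\<not> y < x"
    then have "x < y" using that Cons.prems(2) by (metis distinct.simps(2) linorder_neqE_nat)
    then have "order_isomorphic [x, y] [1, 2]"
      by (auto simp: order_isomorphic_def less_Suc_eq)
    moreover have "subseq [x, y] (x # xs)" using that by (simp add: subseq_singleton_left)
    ultimately show False using Cons.prems(1) by (auto simp: avoids_def contains_pattern_def)
  qed
  moreover have "avoids xs [1, 2]" using Cons.prems(1) by (rule avoids_mono) auto
  ultimately show ?case using Cons by simp
qed simp

lemma subseq_sorted_wrt: "subseq xs ys \<Longrightarrow> sorted_wrt P ys \<Longrightarrow> sorted_wrt P xs"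
proof (induction rule: list_emb.induct)
  case (list_emb_Cons2 x y xs ys)
  then show ?case using subseq_imp_subset[OF list_emb_Cons2.hyps(2)] by auto
qed auto

text \<open>This serves both patterns of the base case: counting from 0, 312 rises from position 1
  to 2 and 12 from position 0 to 1.\<close>

lemma decreasing_avoids:
  assumes "sorted_wrt (>) xs" "i < j" "j < length \<tau>" "\<tau> ! i < \<tau> ! j"
  shows "avoids xs \<tau>"
  unfolding avoids_def
proof
  assume "contains_pattern xs \<tau>"
  then obtain zs where zs: "subseq zs xs" "order_isomorphic zs \<tau>"
    by (auto simp: contains_pattern_def)
  have "sorted_wrt (>) zs"
    using zs(1) assms(1) by (rule subseq_sorted_wrt)
  moreover have "length zs = length \<tau>" "zs ! i < zs ! j"
    using zs(2) assms(2-4) by (auto simp: order_isomorphic_def)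
  ultimately show False using assms(2,3) sorted_wrt_nth_less by fastforce
qed

lemma m_hat_2: "m_hat 2 = [1, 2]"
  by (simp add: m_hat_def)

lemma avoiders_m_hat_2: "avoiders (m_hat 2) a n = {rev [a..<a + n]}"
proof (intro equalityI subsetI)
  fix \<sigma> assume \<sigma>: "\<sigma> \<in> avoiders (m_hat 2) a n"
  have "sorted_wrt (>) \<sigma>"
    using avoids_12_imp_decreasing avoidersD(2)[OF \<sigma>] \<sigma> by (simp add: avoiders_def m_hat_2)
  then have "rev \<sigma> = [a..<a + n]"
    using avoidersD(1)[OF \<sigma>] by (intro strict_sorted_equal) (simp_all add: sorted_wrt_rev)
  then show "\<sigma> \<in> {rev [a..<a + n]}" by (metis rev_rev_ident singletonI)
next
  fix \<sigma> assume "\<sigma> \<in> {rev [a..<a + n]}"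
  then have \<sigma>: "\<sigma> = rev [a..<a + n]" by simp
  then have "sorted_wrt (>) \<sigma>" by (simp add: sorted_wrt_rev)
  then have "avoids \<sigma> [3, 1, 2]" "avoids \<sigma> (m_hat 2)"
    using decreasing_avoids[of \<sigma> 1 2 "[3, 1, 2]"] decreasing_avoids[of \<sigma> 0 1 "m_hat 2"]
    by (simp_all add: m_hat_2)
  then show "\<sigma> \<in> avoiders (m_hat 2) a n"
    using \<sigma> by (simp add: avoiders_def permutations_of_set_def)
qed

lemma longest_inc_Nil [simp]: "longest_inc [] = 0"
  using longest_inc_attained[of "[]"] by (metis list.size(3) list_emb_Nil2)

lemma longest_inc_rev_upt: "longest_inc (rev [a..<a + n]) = (if n = 0 then 0 else 1)"
proof (induction n arbitrary: a)
  case (Suc n)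
  have "rev [a..<a + Suc n] = rev [Suc a..<Suc a + n] @ [a]"
    by (simp add: upt_conv_Cons del: upt_Suc)
  moreover have "longest_inc (rev [Suc a..<Suc a + n] @ [a]) = 1"
    using Suc.IH[of "Suc a"] by (subst longest_inc_snoc_least) (simp_all del: upt_Suc)
  ultimately show ?case by simp
qed simp

lemma longest_inc_eq_0_iff: "longest_inc \<sigma> = 0 \<longleftrightarrow> \<sigma> = []"
proof
  assume *: "longest_inc \<sigma> = 0"
  show "\<sigma> = []"
  proof (rule ccontr)
    assume "\<sigma> \<noteq> []"
    then have "length [hd \<sigma>] \<le> longest_inc \<sigma>"
      by (intro longest_inc_ge) (simp_all add: subseq_singleton_left)
    then show False using * by simp
  qed
qed simp

lemma avoiders_0: "\<tau> \<noteq> [] \<Longrightarrow> avoiders \<tau> a 0 = {[]}"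
  by (auto simp: avoiders_def avoids_def contains_pattern_def order_isomorphic_def)

subsection \<open>Coefficients at simple and double poles\<close>

text \<open>The power series of \<open>1 / (1 - r x)\<close>.\<close>

definition geometric_fps :: "real \<Rightarrow> real fps" where
  "geometric_fps r = Abs_fps (\<lambda>n. r ^ n)"

lemma geometric_fps_nth [simp]: "fps_nth (geometric_fps r) n = r ^ n"
  by (simp add: geometric_fps_def)

lemma geometric_fps_mult_linear: "geometric_fps r * fps_of_poly [:1, - r:] = 1"
proof (rule fps_ext)
  fix n
  show "fps_nth (geometric_fps r * fps_of_poly [:1, - r:]) n = fps_nth 1 n"
    by (cases n) (simp_all add: fps_of_poly_pCons algebra_simps)
qed

lemma geometric_fps_square_nth: "fps_nth (geometric_fps r ^ 2) n = real (n + 1) * r ^ n"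
proof -
  have "(\<Sum>i=0..n. r ^ i * r ^ (n - i)) = (\<Sum>i=0..n. r ^ n)"
    by (intro sum.cong) (simp_all flip: power_add)
  then show ?thesis by (simp add: power2_eq_square fps_mult_nth)
qed

lemma geometric_fps_conv_radius:
  assumes "0 \<le> \<mu>" "\<mu> < \<rho>"
  shows "fps_conv_radius (geometric_fps \<mu>) > ereal (1 / \<rho>)"
proof -
  \<comment> \<open>The reciprocal of the midpoint of \<open>\<mu>\<close> and
    \<open>\<rho>\<close>: it exceeds \<open>1 / \<rho>\<close>, still satisfies
    \<open>\<mu> * s < 1\<close>, and makes sense for \<open>\<mu> = 0\<close> as well.\<close>
  define s where "s = 2 / (\<rho> + \<mu>)"
  have s: "s > 1 / \<rho>" "0 \<le> \<mu> * s" "\<mu> * s < 1" "s > 0"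
    using assms by (simp_all add: s_def field_simps)
  have "summable (\<lambda>n. (\<mu> * s) ^ n)" using s by (simp add: summable_geometric_iff)
  then have "summable (\<lambda>n. fps_nth (geometric_fps \<mu>) n * s ^ n)"
    by (simp add: power_mult_distrib)
  then have "fps_conv_radius (geometric_fps \<mu>) \<ge> norm s"
    unfolding fps_conv_radius_def by (rule conv_radius_geI)
  moreover have "ereal (1 / \<rho>) < ereal (norm s)" using s by simp
  ultimately show ?thesis by (meson less_le_trans)
qed

text \<open>Divided by \<open>\<rho> ^ n\<close>, the coefficients of the product are exactly the
  partial sums of \<open>f\<close> at \<open>1 / \<rho>\<close>, which lies inside the disc of
  convergence.\<close>

lemma simple_pole_coeff_asymp:
  fixes f :: "real fps"
  assumes \<rho>: "\<rho> > 0" and conv: "fps_conv_radius f > ereal (1 / \<rho>)"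
  shows "(\<lambda>n. fps_nth (f * geometric_fps \<rho>) n / \<rho> ^ n) \<longlonglongrightarrow> eval_fps f (1 / \<rho>)"
proof -
  have "(\<lambda>n. fps_nth f n * (1 / \<rho>) ^ n) sums eval_fps f (1 / \<rho>)"
    using \<rho> conv by (intro sums_eval_fps) simp
  then have "(\<lambda>n. \<Sum>i\<le>n. fps_nth f i * (1 / \<rho>) ^ i) \<longlonglongrightarrow> eval_fps f (1 / \<rho>)"
    by (simp add: sums_def_le)
  moreover have "(\<Sum>i\<le>n. fps_nth f i * (1 / \<rho>) ^ i) = fps_nth (f * geometric_fps \<rho>) n / \<rho> ^ n" for n
    using \<rho> by (simp add: fps_mult_nth atLeast0AtMost sum_divide_distrib)
      (intro sum.cong, simp_all add: power_diff field_simps)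
  ultimately show ?thesis by simp
qed

text \<open>Divided by \<open>\<rho> ^ n\<close>, the coefficient is the sum of
  \<open>(n + 1 - i) f_i / \<rho> ^ i\<close> over \<open>i \<le> n\<close>, which is
  \<open>(n + 1) S n - T n\<close> with \<open>S\<close> and \<open>T\<close> the partial sums of
  \<open>f\<close> and \<open>x f'\<close> at \<open>1 / \<rho>\<close>. Both converge, so only
  \<open>S\<close> survives division by \<open>n\<close>.\<close>

lemma double_pole_coeff_asymp:
  fixes f :: "real fps"
  assumes \<rho>: "\<rho> > 0" and conv: "fps_conv_radius f > ereal (1 / \<rho>)"
  shows "(\<lambda>n. fps_nth (f * geometric_fps \<rho> ^ 2) n / (real n * \<rho> ^ n)) \<longlonglongrightarrow> eval_fps f (1 / \<rho>)"
proof -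
  define S where "S n = (\<Sum>i\<le>n. fps_nth f i * (1 / \<rho>) ^ i)" for n
  define T where "T n = (\<Sum>i\<le>n. fps_nth (fps_X * fps_deriv f) i * (1 / \<rho>) ^ i)" for n
  have "(\<lambda>n. fps_nth f n * (1 / \<rho>) ^ n) sums eval_fps f (1 / \<rho>)"
    using \<rho> conv by (intro sums_eval_fps) simp
  then have S: "S \<longlonglongrightarrow> eval_fps f (1 / \<rho>)"
    by (simp add: sums_def_le S_def[abs_def])
  have "fps_conv_radius f \<le> fps_conv_radius (fps_X * fps_deriv f)"
    using fps_conv_radius_mult[of fps_X "fps_deriv f"] fps_conv_radius_deriv[of f]
    by (auto intro: order.trans)
  then have "fps_conv_radius (fps_X * fps_deriv f) > ereal (1 / \<rho>)"
    using conv by (rule less_le_trans[rotated])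
  then have "(\<lambda>n. fps_nth (fps_X * fps_deriv f) n * (1 / \<rho>) ^ n) sums eval_fps (fps_X * fps_deriv f) (1 / \<rho>)"
    using \<rho> by (intro sums_eval_fps) simp
  then have "T \<longlonglongrightarrow> eval_fps (fps_X * fps_deriv f) (1 / \<rho>)"
    by (simp add: sums_def_le T_def[abs_def])
  then have T: "(\<lambda>n. T n * (1 / real n)) \<longlonglongrightarrow> eval_fps (fps_X * fps_deriv f) (1 / \<rho>) * 0"
    by (intro tendsto_mult lim_1_over_n)
  have deriv: "fps_nth (fps_X * fps_deriv f) i = real i * fps_nth f i" for i
    by (cases i) simp_all
  have eq: "fps_nth (f * geometric_fps \<rho> ^ 2) n / \<rho> ^ n = real (n + 1) * S n - T n" for n
  proof -
    have "fps_nth (f * geometric_fps \<rho> ^ 2) n / \<rho> ^ n =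
        (\<Sum>i\<le>n. fps_nth f i * (real (n - i + 1) * \<rho> ^ (n - i)) / \<rho> ^ n)"
      by (simp only: fps_mult_nth geometric_fps_square_nth atLeast0AtMost sum_divide_distrib)
    also have "\<dots> = (\<Sum>i\<le>n. real (n + 1) * (fps_nth f i * (1 / \<rho>) ^ i) -
        fps_nth (fps_X * fps_deriv f) i * (1 / \<rho>) ^ i)"
    proof (rule sum.cong[OF refl])
      fix i assume "i \<in> {..n}"
      then have "i \<le> n" by simp
      then have "\<rho> ^ (n - i) / \<rho> ^ n = (1 / \<rho>) ^ i"
        using \<rho> by (simp add: power_diff field_simps)
      moreover have "real (n - i + 1) = real (n + 1) - real i" using \<open>i \<le> n\<close> by simp
      ultimately have "fps_nth f i * (real (n - i + 1) * \<rho> ^ (n - i)) / \<rho> ^ n =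
          fps_nth f i * (real (n + 1) - real i) * (1 / \<rho>) ^ i"
        by (metis mult.assoc times_divide_eq_right)
      then show "fps_nth f i * (real (n - i + 1) * \<rho> ^ (n - i)) / \<rho> ^ n =
          real (n + 1) * (fps_nth f i * (1 / \<rho>) ^ i) - fps_nth (fps_X * fps_deriv f) i * (1 / \<rho>) ^ i"
        unfolding deriv by (simp add: algebra_simps)
    qed
    also have "\<dots> = real (n + 1) * S n - T n"
      by (simp add: S_def T_def sum_subtractf sum_distrib_left)
    finally show ?thesis .
  qed
  have "(\<lambda>n. (1 + 1 / real n) * S n - T n * (1 / real n)) \<longlonglongrightarrow>
      (1 + 0) * eval_fps f (1 / \<rho>) - eval_fps (fps_X * fps_deriv f) (1 / \<rho>) * 0"
    by (intro tendsto_diff tendsto_mult tendsto_add tendsto_const lim_1_over_n S T)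
  then have lim: "(\<lambda>n. (1 + 1 / real n) * S n - T n * (1 / real n)) \<longlonglongrightarrow> eval_fps f (1 / \<rho>)"
    by simp
  show ?thesis
  proof (rule Lim_transform_eventually[OF lim])
    show "\<forall>\<^sub>F n in sequentially. (1 + 1 / real n) * S n - T n * (1 / real n) =
        fps_nth (f * geometric_fps \<rho> ^ 2) n / (real n * \<rho> ^ n)"
      using eventually_gt_at_top[of 0]
    proof eventually_elim
      case (elim n)
      have "fps_nth (f * geometric_fps \<rho> ^ 2) n / (real n * \<rho> ^ n) =
          (real (n + 1) * S n - T n) / real n"
        unfolding eq[symmetric] by simp
      also have "\<dots> = (1 + 1 / real n) * S n - T n * (1 / real n)"
        using elim by (simp add: field_simps)
      finally show ?case by simp
    qed
  qed
qed

subsection \<open>Reversed Chebyshev polynomials\<close>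

text \<open>These are the Chebyshev polynomials \<open>U\<^sub>m\<close> in the variable \<open>x = 1 / (4 t\<^sup>2)\<close>,
  divided by \<open>(2 t)\<^sup>m\<close>.\<close>

fun cheb_rev :: "nat \<Rightarrow> real poly" where
  "cheb_rev 0 = 1"
| "cheb_rev (Suc 0) = 1"
| "cheb_rev (Suc (Suc m)) = cheb_rev (Suc m) - [:0, 1:] * cheb_rev m"

text \<open>The index is shifted: \<open>lis_numer i\<close>, \<open>count_fps i\<close> and \<open>lis_fps i\<close> belong to
  the pattern \<open>m_hat (i + 2)\<close>.\<close>

primrec lis_numer :: "nat \<Rightarrow> real poly" where
  "lis_numer 0 = [:0, 1, -1:]"
| "lis_numer (Suc i) = [:0, 1:] * ((cheb_rev (Suc (Suc i)))\<^sup>2 + lis_numer i)"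

text \<open>Since \<open>4 t\<^sup>2 x = 1\<close>, multiplying the recurrence of
  \<open>cheb_rev\<close> by \<open>(2 t) ^ (m + 2)\<close> turns it into that of
  \<open>chebyshev_U\<close>.\<close>

lemma poly_cheb_rev:
  assumes "t \<noteq> 0"
  shows "(2 * t) ^ m * poly (cheb_rev m) (1 / (4 * t\<^sup>2)) = chebyshev_U m t"
proof (induction m rule: cheb_rev.induct)
  case (3 m)
  let ?x = "1 / (4 * t\<^sup>2)"
  have "(2 * t) ^ Suc (Suc m) * poly (cheb_rev (Suc (Suc m))) ?x =
      2 * t * ((2 * t) ^ Suc m * poly (cheb_rev (Suc m)) ?x) -
      (4 * t\<^sup>2 * ?x) * ((2 * t) ^ m * poly (cheb_rev m) ?x)"
    by (simp add: right_diff_distrib power2_eq_square mult.assoc mult.left_commute)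
  also have "4 * t\<^sup>2 * ?x = 1" using assms by simp
  finally show ?case unfolding 3 by simp
qed simp_all

text \<open>With \<open>i = m - 2\<close> the right side is the numerator of the theorem. Each step
  of the recursion contributes the factor \<open>x\<close>, absorbed by \<open>4 t\<^sup>2\<close>,
  and one new square.\<close>

lemma poly_lis_numer:
  assumes "t \<noteq> 0"
  shows "(2 * t) ^ (2 * (i + 2)) * poly (lis_numer i) (1 / (4 * t\<^sup>2)) =
    chebyshev_U 2 t + (\<Sum>j=2..i+1. (chebyshev_U j t)\<^sup>2)"
proof (induction i)
  case 0
  \<comment> \<open>The sum is empty here, and
    \<open>(2 t)^4 (x - x\<^sup>2) = 4 t\<^sup>2 - 1\<close> is the second Chebyshev
    polynomial.\<close>
  show ?case using assms by (simp add: field_simps power2_eq_square numeral_2_eq_2)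
next
  case (Suc i)
  let ?x = "1 / (4 * t\<^sup>2)"
  have "(2 * t) ^ (2 * (Suc i + 2)) = (2 * t) ^ (2 * (i + 2)) * (4 * t\<^sup>2)"
    by (simp add: power2_eq_square)
  moreover have "poly (lis_numer (Suc i)) ?x = ?x * ((poly (cheb_rev (i + 2)) ?x)\<^sup>2 + poly (lis_numer i) ?x)"
    by (simp del: cheb_rev.simps)
  ultimately have "(2 * t) ^ (2 * (Suc i + 2)) * poly (lis_numer (Suc i)) ?x =
      (2 * t) ^ (2 * (i + 2)) * (4 * t\<^sup>2 * ?x) *
        ((poly (cheb_rev (i + 2)) ?x)\<^sup>2 + poly (lis_numer i) ?x)"
    by (simp only: mult.assoc)
  also have "4 * t\<^sup>2 * ?x = 1" using assms by simp
  also have "(2 * t) ^ (2 * (i + 2)) * 1 * ((poly (cheb_rev (i + 2)) ?x)\<^sup>2 + poly (lis_numer i) ?x) =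
      ((2 * t) ^ (i + 2) * poly (cheb_rev (i + 2)) ?x)\<^sup>2 +
      (2 * t) ^ (2 * (i + 2)) * poly (lis_numer i) ?x"
    by (simp only: power_even_eq power_mult_distrib mult_1_right) (simp only: distrib_left)
  finally show ?case
    unfolding Suc poly_cheb_rev[OF assms] by simp
qed

section \<open>Trigonometric zeros and factorization\<close>

lemma sin_times_chebyshev_U: "sin \<theta> * chebyshev_U j (cos \<theta>) = sin (real (j + 1) * \<theta>)"
proof (induction j rule: cheb_rev.induct)
  case 2
  show ?case by (simp add: sin_double)
next
  case (3 j)
  have "sin (real (Suc (Suc j) + 1) * \<theta>) + sin (real (j + 1) * \<theta>) =
      2 * sin (real (Suc j + 1) * \<theta>) * cos \<theta>"
    using sin_add[of "real (Suc j + 1) * \<theta>" \<theta>] sin_diff[of "real (Suc j + 1) * \<theta>" \<theta>]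
    by (simp add: algebra_simps)
  moreover have "sin \<theta> * chebyshev_U (Suc (Suc j)) (cos \<theta>) =
      2 * (sin \<theta> * chebyshev_U (Suc j) (cos \<theta>)) * cos \<theta> - sin \<theta> * chebyshev_U j (cos \<theta>)"
    by (simp add: algebra_simps)
  ultimately show ?case unfolding 3 by simp
qed simp

text \<open>The constant term 1 makes \<open>cheb_rev m\<close> invertible as a power series and
  fixes the scalar in its factorization.\<close>

lemma cheb_rev_at_0: "poly (cheb_rev m) 0 = 1"
  by (induction m rule: cheb_rev.induct) simp_all

lemma degree_cheb_rev: "degree (cheb_rev m) \<le> m div 2"
proof (induction m rule: cheb_rev.induct)
  case (3 m)
  have "degree ([:0, 1:] * cheb_rev m) \<le> 1 + degree (cheb_rev m)"
    by (rule order.trans[OF degree_mult_le]) simp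
  then have "degree ([:0, 1:] * cheb_rev m) \<le> Suc (Suc m) div 2" using 3 by simp
  moreover have "degree (cheb_rev (Suc m)) \<le> Suc (Suc m) div 2"
    using 3 by (meson Suc_le_eq div_le_mono le_SucI order.refl order.trans)
  ultimately show ?case by (simp add: degree_diff_le del: One_nat_def)
qed simp_all

text \<open>For \<open>1 \<le> j \<le> m\<close> these are the zeros of the Chebyshev polynomial
  \<open>U_m\<close>, in decreasing order. Those with \<open>j \<le> m div 2\<close> are the
  positive ones.\<close>

definition cheb_node :: "nat \<Rightarrow> nat \<Rightarrow> real" where
  "cheb_node m j = cos (real j * pi / real (m + 1))"

lemma cheb_node_pos: "1 \<le> j \<Longrightarrow> j \<le> m div 2 \<Longrightarrow> cheb_node m j > 0"
proof -
  assume "1 \<le> j" "j \<le> m div 2"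
  then have "2 * real j < real (m + 1)" by linarith
  then have "real j / real (m + 1) < 1 / 2" by (simp add: field_simps)
  then have "real j / real (m + 1) * pi < 1 / 2 * pi" by (intro mult_strict_right_mono pi_gt_zero)
  then have "real j * pi / real (m + 1) < pi / 2" by simp
  then show ?thesis unfolding cheb_node_def by (intro cos_gt_zero_pi) (auto intro: less_le_trans[of _ 0])
qed

lemma cheb_node_less:
  assumes "i < j" "j \<le> m div 2"
  shows "cheb_node m j < cheb_node m i"
proof -
  have "real j \<le> real (m + 1)" using assms by linarith
  then have "real j / real (m + 1) \<le> 1" by simp
  then have "real j / real (m + 1) * pi \<le> 1 * pi" by (intro mult_right_mono pi_ge_zero)
  then have "real j * pi / real (m + 1) \<le> pi" by simp
  moreover have "real i * pi / real (m + 1) < real j * pi / real (m + 1)"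
    using assms by (intro divide_strict_right_mono mult_strict_right_mono) auto
  ultimately show ?thesis
    unfolding cheb_node_def by (intro cos_monotone_0_pi) auto
qed

text \<open>At the angle \<open>\<theta> = j \<pi> / (m + 1)\<close> the value
  \<open>sin ((m + 1) \<theta>)\<close> vanishes while \<open>sin \<theta>\<close> does not, so
  \<open>U_m\<close> vanishes at the node.\<close>

lemma cheb_rev_root:
  assumes "1 \<le> j" "j \<le> m div 2"
  shows "poly (cheb_rev m) (1 / (4 * (cheb_node m j)\<^sup>2)) = 0"
proof -
  let ?\<theta> = "real j * pi / real (m + 1)"
  have "real j < real (m + 1)" using assms by linarith
  then have "real j / real (m + 1) < 1" by simp
  then have "real j / real (m + 1) * pi < 1 * pi" by (intro mult_strict_right_mono pi_gt_zero)
  then have "?\<theta> < pi" by simp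
  moreover have "0 < ?\<theta>" using assms by simp
  ultimately have "sin ?\<theta> > 0" by (intro sin_gt_zero)
  moreover have "sin ?\<theta> * chebyshev_U m (cos ?\<theta>) = 0"
    unfolding sin_times_chebyshev_U by simp
  ultimately have "chebyshev_U m (cheb_node m j) = 0"
    by (simp add: cheb_node_def)
  then show ?thesis
    using poly_cheb_rev[of "cheb_node m j" m] cheb_node_pos[OF assms] by simp
qed

text \<open>Both sides have degree at most \<open>m div 2\<close> and agree at
  \<open>m div 2 + 1\<close> points: the distinct roots coming from the positive nodes, and 0, where
  both are 1.\<close>

lemma cheb_rev_factorization:
  "cheb_rev m = (\<Prod>j=1..m div 2. [:1, - (4 * (cheb_node m j)\<^sup>2):])"
proof -
  let ?z = "\<lambda>j. 1 / (4 * (cheb_node m j)\<^sup>2)"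
  let ?A = "insert 0 (?z ` {1..m div 2})"
  let ?q = "\<Prod>j=1..m div 2. [:1, - (4 * (cheb_node m j)\<^sup>2):]"
  have inj: "inj_on ?z {1..m div 2}"
  proof (rule linorder_inj_onI)
    fix i j assume ij: "i < j" "i \<in> {1..m div 2}" "j \<in> {1..m div 2}"
    then have "0 < cheb_node m j" "cheb_node m j < cheb_node m i"
      using cheb_node_pos[of j m] cheb_node_less[of i j m] by auto
    then have "(cheb_node m j)\<^sup>2 < (cheb_node m i)\<^sup>2"
      by (intro power_strict_mono) auto
    then show "?z i \<noteq> ?z j" by auto
  qed auto
  have node_nz: "cheb_node m j \<noteq> 0" if "j \<in> {1..m div 2}" for j
    using cheb_node_pos[of j m] that by auto
  have "0 \<notin> ?z ` {1..m div 2}" using node_nz by auto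
  then have card: "card ?A = Suc (m div 2)" using inj by (simp add: card_image)
  show ?thesis
  proof (rule poly_eqI_degree[where A = ?A])
    fix x assume "x \<in> ?A"
    then consider "x = 0" | j where "j \<in> {1..m div 2}" "x = ?z j" by blast
    then show "poly (cheb_rev m) x = poly ?q x"
    proof cases
      case 1
      then show ?thesis by (simp add: cheb_rev_at_0 poly_prod)
    next
      case 2
      then have "poly [:1, - (4 * (cheb_node m j)\<^sup>2):] x = 0" using node_nz[OF 2(1)] by simp
      then have "poly ?q x = 0" using 2(1) by (auto simp: poly_prod)
      then show ?thesis using cheb_rev_root[of j m] 2 by simp
    qed
  next
    show "card ?A > degree (cheb_rev m)"
      using degree_cheb_rev[of m] card by simp
  next
    have "degree ?q \<le> (\<Sum>j=1..m div 2. degree [:1, - (4 * (cheb_node m j)\<^sup>2):])"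
      using degree_prod_sum_le[of "{1..m div 2}" "\<lambda>j. [:1, - (4 * (cheb_node m j)\<^sup>2):]"]
      by (simp only: comp_def finite_atLeastAtMost)
    also have "\<dots> \<le> (\<Sum>j=1..m div 2. 1)" by (intro sum_mono) simp
    finally show "card ?A > degree ?q" using card by simp
  qed
qed

subsection \<open>Generating functions\<close>

text \<open>Closed form for the number of avoiders; \<open>avoiders_fps_coeffs\<close> identifies
  its coefficients.\<close>

definition count_fps :: "nat \<Rightarrow> real fps" where
  "count_fps i = fps_of_poly (cheb_rev (Suc i)) * inverse (fps_of_poly (cheb_rev (Suc (Suc i))))"

definition lis_fps :: "nat \<Rightarrow> real fps" where
  "lis_fps i = fps_of_poly (lis_numer i) * (inverse (fps_of_poly (cheb_rev (Suc (Suc i)))))\<^sup>2"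

lemma fps_of_cheb_rev_inverse:
  "inverse (fps_of_poly (cheb_rev m)) * fps_of_poly (cheb_rev m) = 1"
  by (rule inverse_mult_eq_1) (simp add: cheb_rev_at_0 flip: poly_0_coeff_0)

lemma fps_of_cheb_rev_Suc_Suc:
  "fps_of_poly (cheb_rev (Suc (Suc m))) =
    fps_of_poly (cheb_rev (Suc m)) - fps_X * fps_of_poly (cheb_rev m)"
  by (simp add: fps_of_poly_diff fps_of_poly_mult fps_of_poly_pCons)

text \<open>With \<open>b\<close>, \<open>d\<close>, \<open>e\<close> three consecutive polynomials
  \<open>cheb_rev\<close>, the claim reads \<open>d / e = 1 + x (b / d) (d / e)\<close>, which is
  their recurrence \<open>d = e + x b\<close> divided by \<open>e\<close>.\<close>

lemma count_fps_Suc: "count_fps (Suc i) = 1 + fps_X * (count_fps i * count_fps (Suc i))"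
proof -
  define b d e d' e' where "b = fps_of_poly (cheb_rev (Suc i))"
    and "d = fps_of_poly (cheb_rev (Suc (Suc i)))"
    and "e = fps_of_poly (cheb_rev (Suc (Suc (Suc i))))"
    and "d' = inverse d" and "e' = inverse e"
  note defs = this
  have inv: "d' * d = 1" "e' * e = 1"
    unfolding defs by (rule fps_of_cheb_rev_inverse)+
  have e: "d = e + fps_X * b" unfolding defs fps_of_cheb_rev_Suc_Suc by simp
  have "fps_X * (b * d' * (d * e')) = fps_X * b * e' * (d' * d)"
    by (simp only: mult_ac)
  then have "1 + fps_X * (b * d' * (d * e')) = e' * e + e' * (fps_X * b)"
    unfolding inv by (simp add: mult_ac)
  also have "\<dots> = d * e'" unfolding e by (simp only: distrib_left mult.commute)
  finally show ?thesis unfolding count_fps_def defs by simp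
qed

text \<open>The closed forms give \<open>G' = x (G + 1) F'\<^sup>2\<close> directly. Multiplying
  \<open>F' = 1 + x F F'\<close> by \<open>K = x (G + 1) F'\<close> then yields the claimed
  equation, since \<open>K F' = G'\<close>.\<close>

lemma lis_fps_Suc:
  "lis_fps (Suc i) = fps_X * ((lis_fps i + 1) * count_fps (Suc i) + count_fps i * lis_fps (Suc i))"
proof -
  define d d' e' h where "d = fps_of_poly (cheb_rev (Suc (Suc i)))"
    and "d' = inverse d"
    and "e' = inverse (fps_of_poly (cheb_rev (Suc (Suc (Suc i)))))"
    and "h = fps_of_poly (lis_numer i)"
  have dd: "d' * d = 1" unfolding d_def d'_def by (rule fps_of_cheb_rev_inverse)
  have F1: "count_fps (Suc i) = d * e'" by (simp add: count_fps_def d_def e'_def)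
  have G0: "lis_fps i = h * d'\<^sup>2" by (simp add: lis_fps_def d_def d'_def h_def)
  have G1: "lis_fps (Suc i) = fps_X * (d\<^sup>2 + h) * e'\<^sup>2"
    by (simp add: lis_fps_def d_def e'_def h_def fps_of_poly_mult fps_of_poly_add
        fps_of_poly_power fps_of_poly_pCons del: cheb_rev.simps)
  have key: "(lis_fps i + 1) * (d * d) = d\<^sup>2 + h"
  proof -
    have "(lis_fps i + 1) * (d * d) = h * (d' * d) * (d' * d) + d\<^sup>2"
      by (simp add: G0 power2_eq_square algebra_simps)
    then show ?thesis unfolding dd by simp
  qed
  define F C G K where "F = count_fps (Suc i)" and "C = count_fps i"
    and "G = lis_fps (Suc i)" and "K = fps_X * ((lis_fps i + 1) * F)"
  have KF: "K * F = G"
    unfolding K_def F_def G_def F1 G1 key[symmetric] by (simp add: power2_eq_square mult_ac)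
  have "F = 1 + fps_X * (C * F)" unfolding F_def C_def by (rule count_fps_Suc)
  then have "K * F = K * (1 + fps_X * (C * F))" by simp
  also have "\<dots> = K + fps_X * (C * (K * F))" by (simp add: algebra_simps)
  finally have "G = K + fps_X * (C * G)" unfolding KF .
  then show ?thesis unfolding F_def C_def G_def K_def by (simp add: distrib_left)
qed

lemma count_fps_0: "count_fps 0 = geometric_fps 1"
proof -
  have "inverse (fps_of_poly (cheb_rev (Suc (Suc 0)))) = geometric_fps 1"
    using geometric_fps_mult_linear[of 1] by (intro fps_inverse_unique) (simp add: mult.commute one_pCons)
  then show ?thesis by (simp add: count_fps_def del: cheb_rev.simps(3))
qed

text \<open>The numerator \<open>x - x\<^sup>2\<close> contains a spare factor \<open>1 - x\<close>,
  which cancels one of the two in the denominator \<open>(1 - x)\<^sup>2\<close> of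
  \<open>lis_fps\<close>.\<close>

lemma lis_fps_0: "lis_fps 0 = fps_X * geometric_fps 1"
proof -
  have inv: "inverse (fps_of_poly (cheb_rev (Suc (Suc 0)))) = geometric_fps 1"
    using count_fps_0 by (simp add: count_fps_def del: cheb_rev.simps(3))
  have "fps_of_poly (lis_numer 0) = fps_X * fps_of_poly [:1, -1:]"
    by (simp add: fps_of_poly_pCons)
  then have "lis_fps 0 = fps_X * geometric_fps 1 * (geometric_fps 1 * fps_of_poly [:1, -1:])"
    unfolding lis_fps_def inv by (simp add: power2_eq_square mult_ac)
  then show ?thesis using geometric_fps_mult_linear[of 1] by simp
qed

text \<open>Counts and length totals satisfy the same recurrences as the coefficients of the two
  series. The start \<open>a\<close> stays arbitrary because the parts of a split occupy shifted
  intervals.\<close>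

lemma avoiders_fps_coeffs:
  shows "real (card (avoiders (m_hat (Suc (Suc i))) a n)) = fps_nth (count_fps i) n"
    and "(\<Sum>\<sigma>\<in>avoiders (m_hat (Suc (Suc i))) a n. real (longest_inc \<sigma>)) = fps_nth (lis_fps i) n"
proof (induction i arbitrary: a n)
  case 0
  have av: "avoiders (m_hat (Suc (Suc 0))) a n = {rev [a..<a + n]}" for a n
    using avoiders_m_hat_2 by (simp add: numeral_2_eq_2)
  case 1
  show ?case unfolding av by (simp add: count_fps_0)
  case 2
  show ?case unfolding av using longest_inc_rev_upt[of a n] by (cases n) (simp_all add: lis_fps_0 del: upt_Suc)
next
  case (Suc i)
  let ?\<tau> = "m_hat (Suc (Suc i))" and ?\<tau>' = "m_hat (Suc (Suc (Suc i)))"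
  have m: "Suc (Suc i) \<ge> 2" by simp
  \<comment> \<open>For the fixed longer pattern the recurrence refers to itself through the part
    \<open>ys\<close>, which is shorter than the whole; hence a second, strong induction on
    \<open>n\<close>.\<close>
  have *: "real (card (avoiders ?\<tau>' a n)) = fps_nth (count_fps (Suc i)) n \<and>
      (\<Sum>\<sigma>\<in>avoiders ?\<tau>' a n. real (longest_inc \<sigma>)) = fps_nth (lis_fps (Suc i)) n" for a n
  proof (induction n arbitrary: a rule: less_induct)
    case (less n)
    show ?case
    proof (cases n)
      case 0
      have "?\<tau>' \<noteq> []" by (simp add: m_hat_def)
      then have "avoiders ?\<tau>' a n = {[]}" unfolding 0 by (rule avoiders_0)
      moreover have "fps_nth (count_fps (Suc i)) 0 = 1" by (subst count_fps_Suc) simp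
      moreover have "fps_nth (lis_fps (Suc i)) 0 = 0" by (subst lis_fps_Suc) simp
      ultimately show ?thesis using 0 by simp
    next
      case n: (Suc l)
      let ?A = "\<lambda>k. avoiders ?\<tau> (Suc a) k"
      let ?B = "\<lambda>k. avoiders ?\<tau>' (Suc a + k) (l - k)"
      have B: "real (card (?B k)) = fps_nth (count_fps (Suc i)) (l - k)"
        "(\<Sum>ys\<in>?B k. real (longest_inc ys)) = fps_nth (lis_fps (Suc i)) (l - k)" for k
        using less.IH[of "l - k" "Suc a + k"] n by simp_all
      \<comment> \<open>The added series 1 accounts for the empty \<open>xs\<close>, where the
        minimum \<open>a\<close> alone contributes length 1; for \<open>k > 0\<close> the maximum
        has no effect.\<close>
      have A': "(\<Sum>xs\<in>?A k. real (max 1 (longest_inc xs))) = fps_nth (lis_fps i + 1) k" for k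
      proof (cases k)
        case 0
        have "?\<tau> \<noteq> []" by (simp add: m_hat_def)
        then have "?A k = {[]}" unfolding 0 by (rule avoiders_0)
        then show ?thesis using Suc.IH(2)[where a = "Suc a" and n = k] 0 by simp
      next
        case (Suc k')
        have "max 1 (longest_inc xs) = longest_inc xs" if "xs \<in> ?A k" for xs
          using avoidersD(3)[OF that] Suc longest_inc_eq_0_iff[of xs] by (cases "longest_inc xs") auto
        then have "(\<Sum>xs\<in>?A k. real (max 1 (longest_inc xs))) = (\<Sum>xs\<in>?A k. real (longest_inc xs))"
          by (intro sum.cong) simp_all
        then show ?thesis using Suc.IH(2)[where a = "Suc a" and n = k] Suc by simp
      qed
      have "real (card (avoiders ?\<tau>' a n)) = (\<Sum>\<sigma>\<in>avoiders ?\<tau>' a (Suc l). 1)"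
        using n by simp
      also have "\<dots> = (\<Sum>k\<le>l. real (card (?A k)) * real (card (?B k)))"
        unfolding sum_avoiders_decompose[OF m] by simp
      also have "\<dots> = fps_nth (count_fps i * count_fps (Suc i)) l"
        unfolding Suc.IH(1) B(1) by (simp add: fps_mult_nth atLeast0AtMost)
      also have "\<dots> = fps_nth (count_fps (Suc i)) n"
        by (subst (2) count_fps_Suc) (simp add: n)
      finally have 1: "real (card (avoiders ?\<tau>' a n)) = fps_nth (count_fps (Suc i)) n" .
      have "(\<Sum>\<sigma>\<in>avoiders ?\<tau>' a n. real (longest_inc \<sigma>)) =
          (\<Sum>k\<le>l. \<Sum>xs\<in>?A k. \<Sum>ys\<in>?B k. real (longest_inc (xs @ a # ys)))"
        unfolding n by (rule sum_avoiders_decompose[OF m])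
      also have "\<dots> = (\<Sum>k\<le>l. \<Sum>xs\<in>?A k. \<Sum>ys\<in>?B k.
          real (max 1 (longest_inc xs)) + real (longest_inc ys))"
      proof (intro sum.cong refl)
        fix k xs ys assume xs: "xs \<in> ?A k" and ys: "ys \<in> ?B k"
        have "longest_inc (xs @ a # ys) = max 1 (longest_inc xs) + longest_inc ys"
          using avoidersD(1)[OF xs] avoidersD(1)[OF ys] by (intro longest_inc_direct_sum) auto
        then show "real (longest_inc (xs @ a # ys)) = real (max 1 (longest_inc xs)) + real (longest_inc ys)"
          by (simp only: of_nat_add)
      qed
      also have "\<dots> = (\<Sum>k\<le>l. (\<Sum>xs\<in>?A k. real (max 1 (longest_inc xs))) * real (card (?B k)) +
          real (card (?A k)) * (\<Sum>ys\<in>?B k. real (longest_inc ys)))"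
        by (simp only: sum.distrib sum_constant sum_distrib_right mult.commute[of "real (card (?B _))"])
      also have "\<dots> = fps_nth ((lis_fps i + 1) * count_fps (Suc i) + count_fps i * lis_fps (Suc i)) l"
        unfolding A' B Suc.IH(1) by (simp add: fps_mult_nth atLeast0AtMost sum.distrib)
      also have "\<dots> = fps_nth (lis_fps (Suc i)) n"
        by (subst (2) lis_fps_Suc) (simp add: n)
      finally show ?thesis using 1 by simp
    qed
  qed
  case 1
  show ?case using * by blast
  case 2
  show ?case using * by blast
qed

subsection \<open>Asymptotics\<close>

text \<open>The node of index 1 is the largest of the positive ones, so its factor carries the
  smallest root, the dominant pole of the generating functions.\<close>

lemma cheb_rev_rest:
  assumes "m \<ge> 2"
  shows "cheb_rev m = [:1, - (4 * (cheb_node m 1)\<^sup>2):] *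
    (\<Prod>j=2..m div 2. [:1, - (4 * (cheb_node m j)\<^sup>2):])"
proof -
  have "{1..m div 2} = insert 1 {2..m div 2}" using assms by auto
  then show ?thesis unfolding cheb_rev_factorization[of m] by simp
qed

lemma fps_conv_radius_prod_geometric:
  assumes "finite J" "\<And>j. j \<in> J \<Longrightarrow> 0 \<le> \<mu> j \<and> \<mu> j < \<rho>"
  shows "fps_conv_radius (\<Prod>j\<in>J. geometric_fps (\<mu> j)) > ereal (1 / \<rho>)"
  using assms
proof (induction rule: finite_induct)
  case (insert j J)
  have "min (fps_conv_radius (geometric_fps (\<mu> j))) (fps_conv_radius (\<Prod>j\<in>J. geometric_fps (\<mu> j)))
      > ereal (1 / \<rho>)"
    using insert geometric_fps_conv_radius[of "\<mu> j" \<rho>] by simp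
  also note fps_conv_radius_mult
  finally show ?case using insert by simp
qed simp

lemma cheb_node_reflect:
  assumes "j \<le> Suc m"
  shows "cheb_node m (Suc m - j) = - cheb_node m j"
proof -
  have "real (Suc m - j) * pi / real (m + 1) = pi - real j * pi / real (m + 1)"
    using assms by (simp add: of_nat_diff field_simps)
  then show ?thesis unfolding cheb_node_def by (simp only: cos_pi_minus)
qed

text \<open>The nodes \<open>j\<close> and \<open>m + 1 - j\<close> are opposite, and for odd \<open>m\<close> the middle one is \<open>0\<close>.\<close>

lemma prod_cheb_nodes:
  assumes m: "m \<ge> 2" and c: "c \<noteq> 0"
  shows "(\<Prod>j=2..m-1. c - cheb_node m j) =
    c ^ (m - 2) * (\<Prod>j=2..m div 2. 1 - (cheb_node m j)\<^sup>2 / c\<^sup>2)"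
proof -
  define h where "h = m div 2"
  have h: "h \<ge> 1" "2 * h \<le> m" "m \<le> 2 * h + 1" using m by (auto simp: h_def)
  \<comment> \<open>Positive nodes other than the first, then the middle block (empty for even
    \<open>m\<close>, the single node 0 for odd \<open>m\<close>), then the negatives of the first
    block.\<close>
  have split: "{2..m-1} = {2..h} \<union> ({h+1..m-h} \<union> {m+1-h..m-1})" using h by auto
  have "(\<Prod>j=2..m-1. c - cheb_node m j) = (\<Prod>j=2..h. c - cheb_node m j) *
      ((\<Prod>j=h+1..m-h. c - cheb_node m j) * (\<Prod>j=m+1-h..m-1. c - cheb_node m j))"
    unfolding split using h by (subst prod.union_disjoint; (subst prod.union_disjoint)?) auto
  also have "(\<Prod>j=m+1-h..m-1. c - cheb_node m j) = (\<Prod>j=2..h. c + cheb_node m j)"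
    by (rule prod.reindex_bij_witness[of _ "\<lambda>j. Suc m - j" "\<lambda>j. Suc m - j"])
       (use h in \<open>auto simp: cheb_node_reflect\<close>)
  also have "(\<Prod>j=h+1..m-h. c - cheb_node m j) = c ^ (m - 2 * h)"
  proof (cases "m = 2 * h")
    case False
    then have m': "m = 2 * h + 1" using h by simp
    have "real (h + 1) * pi / real (m + 1) = pi / 2" by (simp add: m' field_simps)
    then have "cheb_node m (h + 1) = 0" unfolding cheb_node_def by (simp only: cos_pi_half)
    moreover have "{h + 1..m - h} = {h + 1}" using m' by auto
    ultimately show ?thesis using m' by simp
  qed simp
  also have "(\<Prod>j=2..h. c - cheb_node m j) * (c ^ (m - 2 * h) * (\<Prod>j=2..h. c + cheb_node m j)) =
      c ^ (m - 2 * h) * (\<Prod>j=2..h. (c - cheb_node m j) * (c + cheb_node m j))"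
    by (simp add: prod.distrib)
  also have "(\<Prod>j=2..h. (c - cheb_node m j) * (c + cheb_node m j)) =
      (\<Prod>j=2..h. c\<^sup>2 * (1 - (cheb_node m j)\<^sup>2 / c\<^sup>2))"
    using c by (intro prod.cong) (simp_all add: power2_eq_square field_simps)
  also have "\<dots> = c ^ (2 * (h - 1)) * (\<Prod>j=2..h. 1 - (cheb_node m j)\<^sup>2 / c\<^sup>2)"
    by (simp add: prod.distrib power_mult)
  also have "c ^ (m - 2 * h) * (c ^ (2 * (h - 1)) * (\<Prod>j=2..h. 1 - (cheb_node m j)\<^sup>2 / c\<^sup>2)) =
      c ^ (m - 2 * h + 2 * (h - 1)) * (\<Prod>j=2..h. 1 - (cheb_node m j)\<^sup>2 / c\<^sup>2)"
    by (simp only: power_add mult.assoc)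
  also have "m - 2 * h + 2 * (h - 1) = m - 2" using h by simp
  finally show ?thesis unfolding h_def .
qed

text \<open>With \<open>\<rho> = 4 c\<^sup>2\<close>, the inverse of \<open>cheb_rev m\<close> is
  the geometric series of ratio \<open>\<rho>\<close> times \<open>R\<close>, a product of geometric
  series of smaller ratios. So \<open>R\<close> converges beyond \<open>x = 1 / \<rho>\<close>,
  where its value is \<open>1 / Q\<close>, and the two pole lemmas apply.\<close>

lemma avoider_coeffs_asymp:
  fixes m :: nat and c :: real
  assumes m: "m \<ge> 2"
  defines "c \<equiv> cheb_node m 1"
  defines "x \<equiv> 1 / (4 * c\<^sup>2)"
  defines "Q \<equiv> (\<Prod>j=2..m div 2. 1 - (cheb_node m j)\<^sup>2 / c\<^sup>2)"
  shows "Q \<noteq> 0"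
    and "(\<lambda>n. real (card (avoiders (m_hat m) a n)) / (1 / x) ^ n) \<longlonglongrightarrow> poly (cheb_rev (m - 1)) x / Q"
    and "(\<lambda>n. (\<Sum>\<sigma>\<in>avoiders (m_hat m) a n. real (longest_inc \<sigma>)) / (real n * (1 / x) ^ n))
      \<longlonglongrightarrow> poly (lis_numer (m - 2)) x / Q\<^sup>2"
proof -
  define \<rho> where "\<rho> = 4 * c\<^sup>2"
  define R where "R = (\<Prod>j=2..m div 2. geometric_fps (4 * (cheb_node m j)\<^sup>2))"
  define q where "q = (\<Prod>j=2..m div 2. [:1, - (4 * (cheb_node m j)\<^sup>2):])"
  have c: "c > 0" using m unfolding c_def by (intro cheb_node_pos) auto
  then have \<rho>: "\<rho> > 0" "x = 1 / \<rho>" by (simp_all add: \<rho>_def x_def)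
  have radR: "fps_conv_radius R > ereal (1 / \<rho>)" unfolding R_def
  proof (rule fps_conv_radius_prod_geometric)
    fix j assume "j \<in> {2..m div 2}"
    then have "0 < cheb_node m j" "cheb_node m j < c"
      unfolding c_def using cheb_node_pos[of j m] cheb_node_less[of 1 j m] by auto
    then have "(cheb_node m j)\<^sup>2 < c\<^sup>2" by (intro power_strict_mono) auto
    then show "0 \<le> 4 * (cheb_node m j)\<^sup>2 \<and> 4 * (cheb_node m j)\<^sup>2 < \<rho>"
      by (simp add: \<rho>_def)
  qed simp
  have Rq: "R * fps_of_poly q = 1"
  proof -
    have "R * fps_of_poly q = (\<Prod>j=2..m div 2. geometric_fps (4 * (cheb_node m j)\<^sup>2) *
        fps_of_poly [:1, - (4 * (cheb_node m j)\<^sup>2):])"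
      unfolding R_def q_def fps_of_poly_prod by (rule prod.distrib[symmetric])
    then show ?thesis unfolding geometric_fps_mult_linear by simp
  qed
  \<comment> \<open>Evaluating the formal identity \<open>R q = 1\<close> at \<open>x\<close> yields
    both the value of \<open>R\<close> there and \<open>Q \<noteq> 0\<close>.\<close>
  have "eval_fps (R * fps_of_poly q) x = eval_fps R x * poly q x"
    using radR \<rho> by (subst eval_fps_mult) simp_all
  then have eval: "eval_fps R x * poly q x = 1" unfolding Rq by simp
  have "poly q x = Q" unfolding q_def Q_def x_def poly_prod by simp
  then have evalQ: "eval_fps R x * Q = 1" using eval by simp
  then show "Q \<noteq> 0" by auto
  then have evalR: "eval_fps R x = 1 / Q" using evalQ by (rule eq_divide_imp)
  define i where "i = m - 2"
  then have i: "m = Suc (Suc i)" using m by simp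
  have "fps_of_poly (cheb_rev m) * (geometric_fps \<rho> * R) =
      (geometric_fps \<rho> * fps_of_poly [:1, - \<rho>:]) * (R * fps_of_poly q)"
    unfolding cheb_rev_rest[OF m] q_def \<rho>_def c_def by (simp add: fps_of_poly_mult mult_ac)
  then have inv: "inverse (fps_of_poly (cheb_rev m)) = geometric_fps \<rho> * R"
    unfolding Rq geometric_fps_mult_linear by (intro fps_inverse_unique) simp
  have rad: "fps_conv_radius (fps_of_poly p * R) > ereal (1 / \<rho>)" for p
  proof -
    have "ereal (1 / \<rho>) < min (fps_conv_radius (fps_of_poly p)) (fps_conv_radius R)" using radR by simp
    also note fps_conv_radius_mult
    finally show ?thesis .
  qed
  have rad2: "fps_conv_radius (fps_of_poly p * R * R) > ereal (1 / \<rho>)" for p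
  proof -
    have "ereal (1 / \<rho>) < min (fps_conv_radius (fps_of_poly p * R)) (fps_conv_radius R)"
      using radR rad by simp
    also note fps_conv_radius_mult
    finally show ?thesis .
  qed
  have ev: "eval_fps (fps_of_poly p * R) x = poly p x * eval_fps R x" for p
    using radR \<rho> by (subst eval_fps_mult) simp_all
  have ev2: "eval_fps (fps_of_poly p * R * R) x = poly p x * eval_fps R x * eval_fps R x" for p
  proof -
    have "eval_fps (fps_of_poly p * R * R) x = eval_fps (fps_of_poly p * R) x * eval_fps R x"
      using radR rad[of p] \<rho> by (intro eval_fps_mult) simp_all
    then show ?thesis unfolding ev .
  qed
  have count: "count_fps i = fps_of_poly (cheb_rev (m - 1)) * R * geometric_fps \<rho>"
    using inv by (simp add: count_fps_def i mult_ac)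
  have lis: "lis_fps i = fps_of_poly (lis_numer (m - 2)) * R * R * geometric_fps \<rho> ^ 2"
    using inv by (simp add: lis_fps_def i power2_eq_square mult_ac)
  have "(\<lambda>n. fps_nth (count_fps i) n / \<rho> ^ n) \<longlonglongrightarrow> poly (cheb_rev (m - 1)) x / Q"
    using simple_pole_coeff_asymp[OF \<rho>(1) rad] unfolding count \<rho>(2)[symmetric] ev evalR by simp
  then show "(\<lambda>n. real (card (avoiders (m_hat m) a n)) / (1 / x) ^ n) \<longlonglongrightarrow> poly (cheb_rev (m - 1)) x / Q"
    using \<rho> by (simp add: i avoiders_fps_coeffs)
  have "(\<lambda>n. fps_nth (lis_fps i) n / (real n * \<rho> ^ n)) \<longlonglongrightarrow> poly (lis_numer (m - 2)) x / Q\<^sup>2"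
    using double_pole_coeff_asymp[OF \<rho>(1) rad2] unfolding lis \<rho>(2)[symmetric] ev2 evalR
    by (simp add: power2_eq_square)
  then show "(\<lambda>n. (\<Sum>\<sigma>\<in>avoiders (m_hat m) a n. real (longest_inc \<sigma>)) / (real n * (1 / x) ^ n))
      \<longlonglongrightarrow> poly (lis_numer (m - 2)) x / Q\<^sup>2"
    using \<rho> by (simp add: i avoiders_fps_coeffs)
qed

theorem theorem3p8:
  fixes m :: nat and c :: real
  assumes m: "m \<ge> 4"
    and c: "c = cos (pi / real (m + 1))"
  shows "(\<lambda>n. expected_longest_inc (m_hat m) n) \<sim>[at_top]
    (\<lambda>n. (chebyshev_U 2 c + (\<Sum>j=2..m-1. (chebyshev_U j c)\<^sup>2)) /
         (2 ^ (m + 1) * c ^ 3 * chebyshev_U (m - 1) c *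
          (\<Prod>j=2..m-1. c - cos (real j * pi / real (m + 1)))) * real n)"
proof -
  define x where "x = 1 / (4 * c\<^sup>2)"
  define Q where "Q = (\<Prod>j=2..m div 2. 1 - (cheb_node m j)\<^sup>2 / c\<^sup>2)"
  define N where "N = chebyshev_U 2 c + (\<Sum>j=2..m-1. (chebyshev_U j c)\<^sup>2)"
  define V where "V = chebyshev_U (m - 1) c"
  define K where "K = N / (2 ^ (m + 1) * c ^ 3 * V * (\<Prod>j=2..m-1. c - cos (real j * pi / real (m + 1))))"
  define a where "a n = real (card (avoiders (m_hat m) 1 n))" for n
  define b where "b n = (\<Sum>\<sigma>\<in>avoiders (m_hat m) 1 n. real (longest_inc \<sigma>))" for n
  have c_node: "cheb_node m 1 = c" by (simp add: cheb_node_def c)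
  have m2: "m \<ge> 2" using m by simp
  note coeffs = avoider_coeffs_asymp[OF m2, unfolded c_node, folded x_def, folded Q_def]
  note asymp = coeffs(1) coeffs(2)[of 1, folded a_def] coeffs(3)[of 1, folded b_def]
  have angle: "0 < pi / real (m + 1)" "pi / real (m + 1) < pi / 3"
  proof -
    show "pi / real (m + 1) < pi / 3" using m by (intro divide_strict_left_mono) auto
  qed simp
  \<comment> \<open>The bound \<open>c > 1 / 2\<close> makes \<open>U_2(c) = 4 c\<^sup>2 - 1\<close>
    positive, and with it the numerator \<open>N\<close>.\<close>
  have "cos (pi / 3) < cos (pi / real (m + 1))"
    using angle by (intro cos_monotone_0_pi) auto
  then have c_gt: "c > 1 / 2" by (simp add: c cos_60)
  then have c_pos: "c > 0" by simp
  \<comment> \<open>At \<open>\<theta> = \<pi> / (m + 1)\<close> one has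
    \<open>m \<theta> = \<pi> - \<theta>\<close>, so \<open>sin (m \<theta>) = sin \<theta>\<close>
    and in fact \<open>V = 1\<close>.\<close>
  have V_pos: "V > 0"
  proof -
    have "real (m - 1 + 1) * (pi / real (m + 1)) = pi - pi / real (m + 1)"
      using m by (simp add: of_nat_diff field_simps)
    then have "sin (real (m - 1 + 1) * (pi / real (m + 1))) = sin (pi / real (m + 1))"
      by (simp only: sin_pi_minus)
    moreover have "sin (pi / real (m + 1)) > 0"
      using angle pi_gt_zero by (intro sin_gt_zero) linarith+
    ultimately show ?thesis
      using sin_times_chebyshev_U[of "pi / real (m + 1)" "m - 1"] by (simp add: V_def c)
  qed
  have "chebyshev_U 2 c = 4 * c\<^sup>2 - 1" by (simp add: numeral_2_eq_2)
  moreover have "c\<^sup>2 > (1 / 2)\<^sup>2" using c_gt by (intro power_strict_mono) auto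
  ultimately have "chebyshev_U 2 c > 0" by (simp add: power2_eq_square)
  then have N_pos: "N > 0" unfolding N_def by (intro add_pos_nonneg sum_nonneg) auto
  have prod: "(\<Prod>j=2..m-1. c - cos (real j * pi / real (m + 1))) = c ^ (m - 2) * Q"
    using prod_cheb_nodes[OF m2, of c] c_pos by (simp add: cheb_node_def Q_def)
  have P_eq: "(2 * c) ^ (m - 1) * poly (cheb_rev (m - 1)) x = V"
    using poly_cheb_rev[of c "m - 1"] c_pos by (simp add: x_def V_def)
  have H_eq: "(2 * c) ^ (2 * m) * poly (lis_numer (m - 2)) x = N"
  proof -
    have "m - 2 + 2 = m" "m - 2 + 1 = m - 1" using m by simp_all
    then show ?thesis
      using poly_lis_numer[of c "m - 2"] c_pos by (simp only: x_def N_def)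
  qed
  define P H where "P = poly (cheb_rev (m - 1)) x" and "H = poly (lis_numer (m - 2)) x"
  have P_nz: "P \<noteq> 0" using P_eq V_pos by (auto simp: P_def)
  have K_eq: "H / Q\<^sup>2 / (P / Q) = K"
  proof -
    define l where "l = m - 2"
    then have l: "m = Suc (Suc l)" using m2 by simp
    \<comment> \<open>The powers of 2 and \<open>c\<close> collected from the stated denominator,
      from \<open>V\<close> and from the product over the nodes match the power
      \<open>(2 c) ^ (2 m)\<close> in \<open>N\<close>.\<close>
    have "2 ^ (m + 1) * c ^ 3 * (2 * c) ^ (m - 1) * c ^ (m - 2) = (2 * c) ^ (2 * m)"
      unfolding l power_even_eq by (simp add: power_mult_distrib power2_eq_square power3_eq_cube mult_ac)
    then have "K = (2 * c) ^ (2 * m) * H / ((2 * c) ^ (2 * m) * (P * Q))"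
      unfolding K_def prod P_eq[symmetric] H_eq[symmetric] P_def[symmetric] H_def[symmetric]
      by (simp only: mult_ac)
    also have "\<dots> = H / (P * Q)" using c_pos by simp
    finally show ?thesis using asymp(1) P_nz by (simp add: field_simps power2_eq_square)
  qed
  have "K \<noteq> 0" using K_eq N_pos H_eq P_nz asymp(1) by (auto simp: H_def)
  \<comment> \<open>The exponential growth of the total length and of the count cancels in the
    quotient, leaving the factor \<open>n\<close> from the double pole.\<close>
  have "(\<lambda>n. (b n / (real n * (1 / x) ^ n)) / (a n / (1 / x) ^ n)) \<longlonglongrightarrow> H / Q\<^sup>2 / (P / Q)"
    unfolding P_def H_def
    by (rule tendsto_divide[OF asymp(3,2)]) (use asymp(1) P_nz in \<open>simp add: P_def\<close>)
  then have lim: "(\<lambda>n. (b n / (real n * (1 / x) ^ n)) / (a n / (1 / x) ^ n)) \<longlonglongrightarrow> K"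
    unfolding K_eq .
  \<comment> \<open>A nonzero limit makes the sets of avoiders eventually nonempty, so that the
    expectation under \<open>pmf_of_set\<close> is the average \<open>b n / a n\<close>.\<close>
  have "\<forall>\<^sub>F n in at_top. a n / (1 / x) ^ n \<noteq> 0"
    by (rule tendsto_imp_eventually_ne[OF asymp(2)]) (use asymp(1) P_nz in \<open>simp add: P_def\<close>)
  then have "\<forall>\<^sub>F n in at_top. (b n / (real n * (1 / x) ^ n)) / (a n / (1 / x) ^ n) =
      expected_longest_inc (m_hat m) n / real n"
  proof eventually_elim
    case (elim n)
    then have "avoiders (m_hat m) 1 n \<noteq> {}" by (auto simp: a_def)
    then have "expected_longest_inc (m_hat m) n = b n / a n"
      unfolding expected_longest_inc_def S_avoid312_eq_avoiders
      by (simp add: integral_pmf_of_set a_def b_def)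
    then show ?case using c_pos by (simp add: x_def)
  qed
  with lim have "(\<lambda>n. expected_longest_inc (m_hat m) n / real n) \<longlonglongrightarrow> K"
    by (rule Lim_transform_eventually)
  then have "(\<lambda>n. expected_longest_inc (m_hat m) n) \<sim>[at_top] (\<lambda>n. K * real n)"
    using \<open>K \<noteq> 0\<close> by (rule asymp_equivI'_const)
  then show ?thesis unfolding K_def N_def V_def .
qed

end
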